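(* Let $\mathcal S=\mathbb Z^d\cap\times_{i=1}^d[\ell_i,u_i]$ with integers $\ell_i\le u_i$, and let $\mathfrak s\in[0,\frac12)$. Let $\mathcal S^0$ be the set of representative states of the $\mathfrak s$-spaced grid on $\mathcal S$ (defined in the context), and let $L=|\mathcal S^0|$ (which equals the number $|\mathcal M|$ of meta-states). Then $$L\le\left(\frac{\sqrt2}{1-\mathfrak s}\right)^d|\mathcal S|^{1-\mathfrak s}.$$
   Context: The $\mathfrak s$-spaced grid. On axis $i$, the grid points in the non-negative portion (present when $u_i\ge0$) are given by $f_i(0)=\max\{0,\ell_i\}$ and $$f_i(k+1)=\lceil f_i(k)+(f_i(k))^{\mathfrak s}\rceil+1,$$ up to the index $\bar n_i=\min\{k:f_i(k)\ge u_i\}$, where one sets $f_i(\bar n_i)=u_i$. The grid points in the negative portion (present when $\ell_i<0$) are constructed symmetrically: they start at $\min\{0,u_i\}$ and follow the mirrored recursion $f_i(-(k+1))=\lfloor f_i(-k)-(-f_i(-k))^{\mathfrak s}\rfloor-1$ until a value $\le\ell_i$ is reached, that last point being set to $\ell_i$. The set $\mathcal S^0$ of representative states consists of all points of $\mathcal S$ whose $i$-th coordinate is a grid point of axis $i$ for each $i=1,\dots,d$. Representative states are in one-to-one correspondence with meta-states. *)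

theory Defs
  imports "HOL-Analysis.Finite_Cartesian_Product" "HOL.Transcendental"
begin

text \<open>Real power of a nonnegative base with the convention \<open>0\<^sup>0 = 1\<close>
  (whereas \<open>0 powr 0 = 0\<close> in the library). It matters only for \<open>s = 0\<close> at a grid point \<open>0\<close>.\<close>

definition rpow :: "real \<Rightarrow> real \<Rightarrow> real" where
  "rpow x s = (if s = 0 then 1 else x powr s)"

text \<open>The two recursions, before truncation at the far endpoint of the interval.\<close>

primrec up_seq :: "real \<Rightarrow> int \<Rightarrow> nat \<Rightarrow> int" where
  "up_seq s a 0 = a"
| "up_seq s a (Suc k) = \<lceil>real_of_int (up_seq s a k) + rpow (real_of_int (up_seq s a k)) s\<rceil> + 1"

primrec down_seq :: "real \<Rightarrow> int \<Rightarrow> nat \<Rightarrow> int" where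
  "down_seq s b 0 = b"
| "down_seq s b (Suc k) = \<lfloor>real_of_int (down_seq s b k) - rpow (- real_of_int (down_seq s b k)) s\<rfloor> - 1"

definition up_last :: "real \<Rightarrow> int \<Rightarrow> int \<Rightarrow> nat" where
  "up_last s l u = (LEAST k. up_seq s (max 0 l) k \<ge> u)"

definition down_last :: "real \<Rightarrow> int \<Rightarrow> int \<Rightarrow> nat" where
  "down_last s l u = (LEAST k. down_seq s (min 0 u) k \<le> l)"

definition up_point :: "real \<Rightarrow> int \<Rightarrow> int \<Rightarrow> nat \<Rightarrow> int" where
  "up_point s l u k = (if k = up_last s l u then u else up_seq s (max 0 l) k)"

text \<open>\<open>down_point s l u k\<close> is the grid point with index \<open>-k\<close>.\<close>

definition down_point :: "real \<Rightarrow> int \<Rightarrow> int \<Rightarrow> nat \<Rightarrow> int" where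
  "down_point s l u k = (if k = down_last s l u then l else down_seq s (min 0 u) k)"

definition axis_grid :: "real \<Rightarrow> int \<Rightarrow> int \<Rightarrow> int set" where
  "axis_grid s l u =
     (if u \<ge> 0 then {up_point s l u k | k. k \<le> up_last s l u} else {}) \<union>
     (if l < 0 then {down_point s l u k | k. k \<le> down_last s l u} else {})"

definition state_space :: "int ^ 'd \<Rightarrow> int ^ 'd \<Rightarrow> (int ^ 'd) set" where
  "state_space l u = {x. \<forall>i. x $ i \<in> {l $ i..u $ i}}"

definition representative_states :: "real \<Rightarrow> int ^ 'd \<Rightarrow> int ^ 'd \<Rightarrow> (int ^ 'd) set" where
  "representative_states s l u =
     {x \<in> state_space l u. \<forall>i. x $ i \<in> axis_grid s (l $ i) (u $ i)}"

end

theory Submission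
  imports Defs "HOL-Analysis.Convex" "HOL-Analysis.Harmonic_Numbers"
begin

text \<open>
  Write \<open>g x = x powr (1 - s) / (1 - s)\<close>, a primitive of \<open>x powr - s\<close>. Grid gaps at distance \<open>x\<close> from
  the start of a half-axis are at least \<open>x powr s + 1\<close>, so \<open>g\<close> grows by at least \<open>1\<close> per grid step;
  hence a half-axis of length \<open>m\<close> is covered in at most \<open>g (m + 1 / 2) - 1 / 2\<close> steps. The shift by
  \<open>1 / 2\<close> is what makes the two halves add up without loss: the two terms \<open>- 1 / 2\<close> cancel the count
  of the common grid point \<open>0\<close>, and by concavity
  \<open>g (a + 1 / 2) + g (b + 1 / 2) \<le> 2 powr s * g (a + b + 1)\<close>, where \<open>2 powr s \<le> sqrt 2\<close>.
\<close>

section \<open>Tangent and midpoint inequalities for real powers\<close>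

lemma powr_le_tangent:
  fixes x y t :: real
  assumes "0 < x" "0 < y" "0 \<le> t" "t \<le> 1"
  shows "y powr t \<le> x powr t + t * x powr (t - 1) * (y - x)"
proof -
  have "y powr t * x powr (1 - t) \<le> t * y + (1 - t) * x"
    using Youngs_inequality_0[of t "1 - t" y x] assms by simp
  then have "y powr t * x powr (1 - t) * x powr (t - 1) \<le> (t * y + (1 - t) * x) * x powr (t - 1)"
    by (rule mult_right_mono) simp
  moreover have "x powr (1 - t) * x powr (t - 1) = 1"
    using assms by (simp flip: powr_add)
  moreover have "x * x powr (t - 1) = x powr t"
    using assms by (simp add: powr_mult_base)
  ultimately show ?thesis by (simp add: algebra_simps)
qed

text \<open>The tangent at the midpoint bounds both powers, and its linear terms cancel in the
  sum.\<close>

lemma powr_add_le_mean: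
  fixes a b t :: real
  assumes "0 < a" "0 < b" "0 \<le> t" "t \<le> 1"
  shows "a powr t + b powr t \<le> 2 * ((a + b) / 2) powr t"
  using powr_le_tangent[of "(a + b) / 2" a t] powr_le_tangent[of "(a + b) / 2" b t] assms
  by (simp add: field_simps)

section \<open>The primitive \<open>gauge\<close>: lower bounds and growth over one gap\<close>

definition gauge :: "real \<Rightarrow> real \<Rightarrow> real" where
  "gauge s x = x powr (1 - s) / (1 - s)"

lemma gauge_mono: "s < 1 \<Longrightarrow> 0 \<le> x \<Longrightarrow> x \<le> y \<Longrightarrow> gauge s x \<le> gauge s y"
  by (simp add: gauge_def divide_right_mono powr_mono2)

lemma gauge_add_le:
  assumes "0 < a" "0 < b" "0 \<le> s" "s \<le> 1 / 2"
  shows "gauge s a + gauge s b \<le> sqrt 2 * gauge s (a + b)"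
proof -
  have "a powr (1 - s) + b powr (1 - s) \<le> 2 * ((a + b) / 2) powr (1 - s)"
    using assms by (intro powr_add_le_mean) auto
  also have "\<dots> = 2 powr s * (a + b) powr (1 - s)"
    using assms by (simp add: powr_divide powr_diff)
  also have "\<dots> \<le> 2 powr (1 / 2) * (a + b) powr (1 - s)"
    using assms by (intro mult_right_mono powr_mono) auto
  finally show ?thesis
    using assms by (simp add: gauge_def powr_half_sqrt divide_right_mono flip: add_divide_distrib)
qed

text \<open>This amounts to \<open>1 - s \<le> exp (- (s * ln x))\<close>, an instance of
  \<open>1 + t \<le> exp t\<close>.\<close>

lemma gauge_ge_self:
  assumes "0 < x" "ln x \<le> 1" "0 \<le> s" "s < 1"
  shows "x \<le> gauge s x"
proof -
  have "s * ln x \<le> s"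
    using assms by (simp add: mult_left_le)
  then have "1 - s \<le> x powr (- s)"
    using assms exp_ge_add_one_self[of "- (s * ln x)"] by (simp add: powr_def)
  then have "x * (1 - s) \<le> x * x powr (- s)"
    using assms by (intro mult_left_mono) auto
  also have "\<dots> = x powr (1 - s)"
    using assms by (simp add: powr_mult_base)
  finally show ?thesis
    using assms by (simp add: gauge_def pos_le_divide_eq)
qed

text \<open>\<open>x powr (1 - s)\<close> is \<open>sqrt x\<close> times
  \<open>exp ((1 / 2 - s) * ln x)\<close>, and \<open>1 + t \<le> exp t\<close> bounds the second
  factor. The bound is uniform in \<open>s\<close>, so at a fixed \<open>x\<close> only numbers
  remain to be compared.\<close>

lemma gauge_ge_sqrt:
  assumes "0 < x" "2 * c \<le> ln x" "c \<le> 1" "0 \<le> s" "s \<le> 1 / 2"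
  shows "(1 + c) * sqrt x \<le> gauge s x"
proof -
  \<comment> \<open>The right side exceeds the left by \<open>s * (1 - c)\<close>.\<close>
  have "(1 + c) * (1 - s) \<le> 1 + (1 / 2 - s) * (2 * c)"
    using assms mult_right_mono[of c 1 s] by (simp add: algebra_simps)
  also have "\<dots> \<le> 1 + (1 / 2 - s) * ln x"
    using assms by (intro add_left_mono mult_left_mono) auto
  also have "\<dots> \<le> x powr (1 / 2 - s)"
    using assms exp_ge_add_one_self[of "(1 / 2 - s) * ln x"] by (simp add: powr_def)
  finally have "(1 + c) * (1 - s) * sqrt x \<le> x powr (1 / 2 - s) * sqrt x"
    using assms by (intro mult_right_mono) auto
  also have "\<dots> = x powr (1 - s)"
    using assms by (simp flip: powr_half_sqrt powr_add)
  finally show ?thesis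
    using assms by (simp add: gauge_def pos_le_divide_eq algebra_simps)
qed

text \<open>By concavity the growth is at least \<open>\<delta>\<close> times the slope at the right
  end \<open>y = x + \<delta> + c\<close>, so \<open>y powr s \<le> \<delta>\<close> suffices. This
  follows from the tangent of \<open>powr s\<close> at \<open>x\<close>, whose slope is
  \<open>p\<close>.\<close>

lemma gauge_step:
  fixes x \<delta> c s :: real
  assumes "1 \<le> x" "0 \<le> c" "1 + c \<le> sqrt x" "x powr s + 1 \<le> \<delta>" "0 \<le> s" "s \<le> 1 / 2"
  shows "gauge s (x + c) + 1 \<le> gauge s (x + \<delta> + c)"
proof -
  have \<delta>: "0 < \<delta>"
    using assms(4) by (smt (verit) powr_ge_zero)
  define p where "p = s * x powr (s - 1)"
  have p0: "0 \<le> p" using assms by (simp add: p_def)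
  have "x powr (s - 1) \<le> x powr (- (1 / 2))"
    using assms by (intro powr_mono) auto
  also have "\<dots> = 1 / sqrt x"
    using assms by (simp add: powr_minus_divide powr_half_sqrt)
  finally have "x powr (s - 1) * sqrt x \<le> 1"
    using assms by (simp add: pos_le_divide_eq)
  then have "x powr (s - 1) * (1 + c) \<le> 1"
    using mult_left_mono[OF assms(3) powr_ge_zero[of x "s - 1"]] by linarith
  then have "s * (x powr (s - 1) * (1 + c)) \<le> 1 / 2 * 1"
    using assms by (intro mult_mono) auto
  then have p1: "p * (1 + c) \<le> 1 / 2"
    by (simp add: p_def mult.assoc)
  have "p \<le> 1 / 2"
    using p1 mult_nonneg_nonneg[OF p0 assms(2)] by (simp add: distrib_left)
  have "x powr (s - 1) * x powr s \<le> 1"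
    using assms powr_mono[of "2 * s - 1" 0 x] by (simp flip: powr_add)
  then have p2: "p * x powr s \<le> 1 / 2"
    using assms mult_mono[of s "1 / 2" "x powr (s - 1) * x powr s" 1] by (simp add: p_def mult.assoc)
  have "(x + \<delta> + c) powr s \<le> x powr s + p * (\<delta> + c)"
    using powr_le_tangent[of x "x + \<delta> + c" s] assms \<delta> by (simp add: p_def add.assoc)
  also have "\<dots> \<le> \<delta>"
  proof -
    \<comment> \<open>What remains after expansion is
      \<open>p * x powr s + p * (1 + c) \<le> 1\<close>; each summand is at most
      \<open>1 / 2\<close>.\<close>
    have "(x powr s + 1) * (1 - p) \<le> \<delta> * (1 - p)"
      using assms \<open>p \<le> 1 / 2\<close> by (intro mult_right_mono) auto
    then show ?thesis using p1 p2 by (simp add: algebra_simps)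
  qed
  finally have *: "(x + \<delta> + c) powr s \<le> \<delta>" .
  let ?y = "x + \<delta> + c"
  have y: "0 < ?y" using assms \<delta> by auto
  have "1 \<le> ?y powr (- s) * \<delta>"
    using * y by (simp add: powr_minus_divide)
  moreover have "(x + c) powr (1 - s) \<le> ?y powr (1 - s) + (1 - s) * ?y powr (- s) * (- \<delta>)"
    using powr_le_tangent[of ?y "x + c" "1 - s"] assms y by simp
  ultimately have "(x + c) powr (1 - s) + (1 - s) * 1 \<le> ?y powr (1 - s)"
    using assms mult_left_mono[of 1 "?y powr (- s) * \<delta>" "1 - s"] by (simp add: algebra_simps)
  then have "((x + c) powr (1 - s) + (1 - s)) / (1 - s) \<le> ?y powr (1 - s) / (1 - s)"
    using assms by (intro divide_right_mono) auto
  then show ?thesis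
    using assms by (simp add: gauge_def add_divide_distrib)
qed

section \<open>Growth of the grid sequence on a half-axis\<close>

lemma rpow_mono: "0 \<le> s \<Longrightarrow> 0 \<le> x \<Longrightarrow> x \<le> y \<Longrightarrow> rpow x s \<le> rpow y s"
  by (simp add: rpow_def powr_mono2)

lemma rpow_nonneg: "0 \<le> rpow x s"
  by (simp add: rpow_def)

lemma up_seq_diff_nonneg:
  assumes "0 \<le> a"
  shows "0 \<le> up_seq s a k - a"
proof (induction k)
  case (Suc k)
  have "up_seq s a k \<le> \<lceil>real_of_int (up_seq s a k) + rpow (real_of_int (up_seq s a k)) s\<rceil>"
    using rpow_nonneg by (smt (verit) ceiling_mono ceiling_of_int)
  with Suc show ?case by simp
qed simp

text \<open>A half-axis starting at \<open>a \<ge> 0\<close> is at least as sparse as one starting at \<open>0\<close>.\<close>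

lemma up_seq_diff_Suc:
  assumes "0 \<le> a" "0 \<le> s"
  shows "up_seq s a k - a + \<lceil>rpow (real_of_int (up_seq s a k - a)) s\<rceil> + 1 \<le> up_seq s a (Suc k) - a"
proof -
  have "\<lceil>rpow (real_of_int (up_seq s a k - a)) s\<rceil> \<le> \<lceil>rpow (real_of_int (up_seq s a k)) s\<rceil>"
    using assms up_seq_diff_nonneg[OF assms(1), of s k] by (intro ceiling_mono rpow_mono) auto
  moreover have "\<lceil>real_of_int n + r\<rceil> = n + \<lceil>r\<rceil>" for n r
    by linarith
  ultimately show ?thesis
    by simp
qed

text \<open>This crude growth carries the sequence past any \<open>u\<close>, so the
  \<open>LEAST\<close> in \<open>up_last\<close> is attained.\<close>

lemma up_seq_diff_ge:
  assumes "0 \<le> a" "0 \<le> s"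
  shows "int k \<le> up_seq s a k - a"
proof (induction k)
  case (Suc k)
  have "0 \<le> \<lceil>rpow (real_of_int (up_seq s a k - a)) s\<rceil>"
    using rpow_nonneg by (smt (verit) zero_le_ceiling)
  with Suc up_seq_diff_Suc[OF assms, of k] show ?case by linarith
qed simp

lemma gauge_up_seq:
  assumes a: "0 \<le> a" and s: "0 \<le> s" "s \<le> 1 / 2"
  shows "real k + 3 / 2 \<le> gauge s (real_of_int (up_seq s a k - a) + 3 / 2)"
proof -
  define F where "F k = up_seq s a k - a" for k
  have F0: "F 0 = 0" by (simp add: F_def)
  have F_Suc: "F k + \<lceil>rpow (real_of_int (F k)) s\<rceil> + 1 \<le> F (Suc k)" for k
    unfolding F_def by (rule up_seq_diff_Suc[OF a s(1)])
  have ge: "int k \<le> F k" for k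
    unfolding F_def by (rule up_seq_diff_ge[OF a s(1)])
  show ?thesis
  proof (cases "s = 0")
    case True
    \<comment> \<open>For \<open>s = 0\<close> the gauge is the identity on nonnegative numbers; the
      first gap of \<open>2\<close> relies on \<open>rpow 0 0 = 1\<close>.\<close>
    have "2 * int k \<le> F k"
    proof (induction k)
      case (Suc k)
      with F_Suc[of k] True show ?case by (simp add: rpow_def)
    qed (simp add: F0)
    then show ?thesis using True by (simp add: gauge_def F_def)
  next
    case False
    then have s0: "0 < s" using s by simp
    \<comment> \<open>The ceilings force first gaps of at least \<open>1\<close>, \<open>2\<close>,
      \<open>3\<close>, \<open>3\<close>, uniformly in \<open>s > 0\<close>.\<close>
    have st: "F (Suc k) \<ge> F k + 2" if "F k \<ge> 1" for k
    proof -
      have "1 \<le> rpow (real_of_int (F k)) s"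
        using that s s0 by (simp add: rpow_def ge_one_powr_ge_zero)
      then have "1 \<le> \<lceil>rpow (real_of_int (F k)) s\<rceil>" by linarith
      with F_Suc[of k] show ?thesis by linarith
    qed
    have st3: "F (Suc k) \<ge> F k + 3" if "F k \<ge> 2" for k
    proof -
      have "1 < rpow (real_of_int (F k)) s"
        using that s s0 by (simp add: rpow_def gr_one_powr)
      then have "2 \<le> \<lceil>rpow (real_of_int (F k)) s\<rceil>" by linarith
      with F_Suc[of k] show ?thesis by linarith
    qed
    have F1: "1 \<le> F 1" using ge[of 1] by simp
    have F2: "3 \<le> F 2" using st[of 1] F1 by (simp add: numeral_2_eq_2)
    have F3: "6 \<le> F 3" using st3[of 2] F2 by (simp add: numeral_2_eq_2 numeral_3_eq_3)
    have F4: "9 \<le> F 4" using st3[of 3] F3 by (simp add: eval_nat_numeral)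
    have lb: "c \<le> gauge s (real_of_int (F k) + 3 / 2)"
      if "0 \<le> y" "y \<le> real_of_int (F k) + 3 / 2" "c \<le> gauge s y" for c y k
      using that s by (intro order.trans[OF that(3) gauge_mono]) auto
    \<comment> \<open>\<open>(7 / 6) ^ 6\<close> exceeds \<open>5 / 2\<close>, which gives
      \<open>ln (5 / 2) \<le> 1\<close> for the point \<open>F 1\<close>.\<close>
    have "exp (1 / 6) ^ 6 \<ge> (7 / 6 :: real) ^ 6"
      using exp_ge_add_one_self[of "1 / 6 :: real"] by (intro power_mono) auto
    then have "5 / 2 \<le> exp (1::real)"
      by (simp add: power_divide flip: exp_of_nat_mult)
    then have "ln (5 / 2) \<le> ln (exp 1 :: real)"
      by (intro ln_mono) auto
    then have ln52: "ln (5 / 2 :: real) \<le> 1"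
      by simp
    have "ln (4::real) = 2 * ln 2" "ln (8::real) = 3 * ln 2"
      using ln_realpow[of 2 2] ln_realpow[of 2 3] by simp_all
    then have ln4: "4 / 3 \<le> ln (4::real)" and ln8: "2 \<le> ln (8::real)"
      using ln2_ge_two_thirds by simp_all
    \<comment> \<open>The factors are \<open>1 + c\<close>, with \<open>c = 2 / 3\<close> from
      \<open>ln 4\<close> here and \<open>c = 1\<close> from \<open>ln 8\<close> below.\<close>
    have gauge4: "5 / 3 * sqrt y \<le> gauge s y" if "4 \<le> y" for y
    proof -
      have "4 / 3 \<le> ln y" using ln4 that by (smt (verit) ln_mono)
      then show ?thesis using gauge_ge_sqrt[of y "2 / 3" s] that s by simp
    qed
    have gauge8: "2 * sqrt y \<le> gauge s y" if "8 \<le> y" for y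
    proof -
      have "2 \<le> ln y" using ln8 that by (smt (verit) ln_mono)
      then show ?thesis using gauge_ge_sqrt[of y 1 s] that s by simp
    qed
    txt \<open>For \<open>s\<close> near \<open>1 / 2\<close> the increment of \<open>gauge\<close>, at a point shifted by \<open>3 / 2\<close>, is guaranteed
      to be at least \<open>1\<close> only for \<open>sqrt (F k) \<ge> 5 / 2\<close>, so the first five points are done by hand.\<close>
    have b0: "real 0 + 3 / 2 \<le> gauge s (real_of_int (F 0) + 3 / 2)"
      using gauge_ge_self[of "3 / 2" s] ln_le_minus_one[of "3 / 2"] s F0 by simp
    have b1: "real 1 + 3 / 2 \<le> gauge s (real_of_int (F 1) + 3 / 2)"
      using F1 gauge_ge_self[of "5 / 2" s] ln52 s by (intro lb[of "5 / 2"]) auto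
    have b2: "real 2 + 3 / 2 \<le> gauge s (real_of_int (F 2) + 3 / 2)"
    proof (rule lb[of "9 / 2"])
      \<comment> \<open>\<open>5 / 3 * (21 / 10)\<close> is exactly the target \<open>7 / 2\<close>;
        \<open>27 / 10\<close> likewise gives \<open>9 / 2\<close> in the next case.\<close>
      have "21 / 10 \<le> sqrt (9 / 2)" by (rule real_le_rsqrt) (simp add: power2_eq_square)
      with gauge4[of "9 / 2"] show "real 2 + 3 / 2 \<le> gauge s (9 / 2)" by simp
    qed (use F2 in auto)
    have b3: "real 3 + 3 / 2 \<le> gauge s (real_of_int (F 3) + 3 / 2)"
    proof (rule lb[of "15 / 2"])
      have "27 / 10 \<le> sqrt (15 / 2)" by (rule real_le_rsqrt) (simp add: power2_eq_square)
      with gauge4[of "15 / 2"] show "real 3 + 3 / 2 \<le> gauge s (15 / 2)" by simp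
    qed (use F3 in auto)
    have b4: "real 4 + 3 / 2 \<le> gauge s (real_of_int (F 4) + 3 / 2)"
    proof (rule lb[of "21 / 2"])
      have "3 \<le> sqrt (21 / 2)" by (rule real_le_rsqrt) (simp add: power2_eq_square)
      with gauge8[of "21 / 2"] show "real 4 + 3 / 2 \<le> gauge s (21 / 2)" by simp
    qed (use F4 in auto)
    have ind: "9 \<le> F k \<and> real k + 3 / 2 \<le> gauge s (real_of_int (F k) + 3 / 2)" if "4 \<le> k" for k
      using that
    proof (induction k rule: dec_induct)
      case base
      then show ?case using F4 b4 by simp
    next
      case (step k)
      define \<delta> where "\<delta> = real_of_int (F (Suc k) - F k)"
      have "real_of_int (F k) powr s + 1 \<le> \<delta>"
        using F_Suc[of k] False by (simp add: rpow_def \<delta>_def) linarith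
      moreover have "1 + 3 / 2 \<le> sqrt (real_of_int (F k))"
        using step by (intro real_le_rsqrt) (simp add: power2_eq_square)
      ultimately have "gauge s (real_of_int (F k) + 3 / 2) + 1
          \<le> gauge s (real_of_int (F k) + \<delta> + 3 / 2)"
        using step s by (intro gauge_step) auto
      then show ?case using step st[of k] by (simp add: \<delta>_def)
    qed
    have "k = 0 \<or> k = 1 \<or> k = 2 \<or> k = 3 \<or> 4 \<le> k" by linarith
    then show ?thesis
      using b0 b1 b2 b3 ind[of k] unfolding F_def by blast
  qed
qed

lemma up_last_gauge:
  assumes "0 \<le> s" "s \<le> 1 / 2" "0 \<le> u" "l \<le> u"
  shows "real (up_last s l u) + 1 / 2 \<le> gauge s (real_of_int (u - max 0 l) + 1 / 2)"
proof (cases "up_last s l u")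
  case 0
  have "1 / 2 \<le> gauge s (1 / 2)"
    using assms ln_le_minus_one[of "1 / 2"] by (intro gauge_ge_self) auto
  also have "\<dots> \<le> gauge s (real_of_int (u - max 0 l) + 1 / 2)"
    using assms by (intro gauge_mono) auto
  finally show ?thesis using 0 by simp
next
  case (Suc n)
  have "n < (LEAST k. u \<le> up_seq s (max 0 l) k)"
    using Suc by (simp add: up_last_def)
  then have "\<not> u \<le> up_seq s (max 0 l) n"
    by (rule not_less_Least)
  \<comment> \<open>By integrality the point before the last is at most \<open>u - 1\<close>, so the
    shift \<open>3 / 2\<close> becomes \<open>1 / 2\<close>; on the index side
    \<open>n + 3 / 2 = Suc n + 1 / 2\<close>.\<close>
  then have "real_of_int (up_seq s (max 0 l) n - max 0 l) + 3 / 2 \<le> real_of_int (u - max 0 l) + 1 / 2"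
    by linarith
  moreover have "0 \<le> up_seq s (max 0 l) n - max 0 l"
    by (rule up_seq_diff_nonneg) simp
  ultimately have "gauge s (real_of_int (up_seq s (max 0 l) n - max 0 l) + 3 / 2)
      \<le> gauge s (real_of_int (u - max 0 l) + 1 / 2)"
    using assms by (intro gauge_mono) auto
  with gauge_up_seq[of "max 0 l" s n] assms Suc show ?thesis by simp
qed

section \<open>Reflection of the negative half and counting on one axis\<close>

lemma down_seq_eq: "down_seq s b k = - up_seq s (- b) k"
proof (induction k)
  case (Suc k)
  have "\<lfloor>- real_of_int n - r\<rfloor> = - \<lceil>real_of_int n + r\<rceil>" for n r
    by linarith
  with Suc show ?case by simp
qed simp

text \<open>Negation swaps floor and ceiling, so bounds for the negative half are those for the
  upward sequence on the reflected interval.\<close>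

lemma down_last_eq: "down_last s l u = up_last s (- u) (- l)"
proof -
  have "- min 0 u = max 0 (- u)" by auto
  then show ?thesis
    by (simp add: down_last_def up_last_def down_seq_eq minus_le_iff)
qed

lemma card_indexed_le: "card {f k | k. k \<le> n} \<le> Suc n" for n :: nat
proof -
  have "{f k | k. k \<le> n} = f ` {..n}" by auto
  then show ?thesis by (metis card_atMost card_image_le finite_atMost)
qed

lemma card_Un_common_le:
  assumes "finite A" "finite B" "x \<in> A" "x \<in> B"
  shows "card (A \<union> B) + 1 \<le> card A + card B"
proof -
  have "card (A \<inter> B) > 0"
    using assms by (auto simp: card_gt_0_iff)
  then show ?thesis
    using card_Un_Int[OF assms(1,2)] by linarith
qed

lemma up_seq_up_last:
  assumes "0 \<le> s"
  shows "u \<le> up_seq s (max 0 l) (up_last s l u)"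
  unfolding up_last_def
proof (rule LeastI[of _ "nat u"])
  show "u \<le> up_seq s (max 0 l) (nat u)"
    using up_seq_diff_ge[of "max 0 l" s "nat u"] assms by linarith
qed

text \<open>If index \<open>0\<close> is already the last, the point is reset to \<open>u\<close>;
  but then \<open>u \<le> 0\<close> by \<open>up_seq_up_last\<close>, so the reset still gives
  \<open>0\<close>.\<close>

lemma up_point_0:
  assumes "0 \<le> s" "l \<le> 0" "0 \<le> u"
  shows "up_point s l u 0 = 0"
  using up_seq_up_last[OF assms(1), of u l] assms by (auto simp: up_point_def)

lemma down_point_0:
  assumes "0 \<le> s" "l \<le> 0" "0 \<le> u"
  shows "down_point s l u 0 = 0"
  using up_seq_up_last[OF assms(1), of "- l" "- u"] assms
  by (auto simp: down_point_def down_last_eq)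

lemma card_axis_grid:
  assumes "0 \<le> s" "s \<le> 1 / 2" "l \<le> u"
  shows "real (card (axis_grid s l u)) \<le> sqrt 2 * gauge s (real_of_int (u - l + 1))"
proof -
  let ?U = "{up_point s l u k | k. k \<le> up_last s l u}"
  let ?D = "{down_point s l u k | k. k \<le> down_last s l u}"
  have half: "1 / 2 \<le> gauge s (1 / 2)"
    using assms ln_le_minus_one[of "1 / 2"] by (intro gauge_ge_self) auto
  have "\<exists>a b. 0 \<le> a \<and> 0 \<le> b \<and> a + b = real_of_int (u - l) \<and>
      real (card (axis_grid s l u)) \<le> gauge s (a + 1 / 2) + gauge s (b + 1 / 2)"
  proof -
    consider "0 \<le> l" | "u < 0" | "l < 0" "0 \<le> u" by linarith
    then show ?thesis
    proof cases
      case 1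
      then have "real (card (axis_grid s l u)) \<le> real (up_last s l u) + 1"
        using assms card_indexed_le[of "up_point s l u" "up_last s l u"] by (simp add: axis_grid_def)
      \<comment> \<open>A one-sided grid takes \<open>b = 0\<close>;
        \<open>1 / 2 \<le> gauge s (1 / 2)\<close> pays for the missing half.\<close>
      with up_last_gauge[of s u l] 1 assms half
      show ?thesis by (intro exI[of _ "real_of_int (u - l)"] exI[of _ 0]) simp
    next
      case 2
      then have "real (card (axis_grid s l u)) \<le> real (up_last s (- u) (- l)) + 1"
        using assms card_indexed_le[of "down_point s l u" "down_last s l u"]
        by (simp add: axis_grid_def down_last_eq)
      with up_last_gauge[of s "- l" "- u"] 2 assms half
      show ?thesis by (intro exI[of _ "real_of_int (u - l)"] exI[of _ 0]) simp
    next
      case 3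
      have fin: "finite ?U" "finite ?D" by auto
      \<comment> \<open>Counting the shared point \<open>0\<close> once saves the \<open>1\<close>
        that leaves each half with \<open>1 / 2\<close>.\<close>
      have "0 \<in> ?U" "0 \<in> ?D"
        using up_point_0[of s l u] down_point_0[of s l u] 3 assms by force+
      then have "card (?U \<union> ?D) + 1 \<le> card ?U + card ?D"
        by (rule card_Un_common_le[OF fin])
      then have "card (?U \<union> ?D) + 1 \<le> (up_last s l u + 1) + (down_last s l u + 1)"
        using card_indexed_le[of "up_point s l u" "up_last s l u"]
          card_indexed_le[of "down_point s l u" "down_last s l u"] by linarith
      then have "real (card (axis_grid s l u))
          \<le> real (up_last s l u) + 1 / 2 + (real (up_last s (- u) (- l)) + 1 / 2)"
        using 3 by (simp add: axis_grid_def down_last_eq)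
      with up_last_gauge[of s u l] up_last_gauge[of s "- l" "- u"] 3 assms
      show ?thesis by (intro exI[of _ "real_of_int u"] exI[of _ "real_of_int (- l)"]) simp
    qed
  qed
  then obtain a b where ab: "0 \<le> a" "0 \<le> b" "a + b = real_of_int (u - l)"
    and le: "real (card (axis_grid s l u)) \<le> gauge s (a + 1 / 2) + gauge s (b + 1 / 2)"
    by blast
  note le
  also have "gauge s (a + 1 / 2) + gauge s (b + 1 / 2) \<le> sqrt 2 * gauge s (a + 1 / 2 + (b + 1 / 2))"
    using ab assms by (intro gauge_add_le) auto
  \<comment> \<open>The two shifts turn the length \<open>u - l\<close> into the number of integers
    in the interval.\<close>
  also have "a + 1 / 2 + (b + 1 / 2) = real_of_int (u - l + 1)"
    using ab by simp
  finally show ?thesis .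
qed

lemma finite_axis_grid: "finite (axis_grid s l u)"
  by (simp add: axis_grid_def)

section \<open>Products over the axes\<close>

lemma bij_betw_vec_nth_box:
  "bij_betw vec_nth {x. \<forall>i. x $ i \<in> A i} (\<Pi>\<^sub>E i\<in>UNIV. A i)"
  by (rule bij_betw_byWitness[where f' = vec_lambda]) (auto simp: PiE_def)

lemma card_vec_box: "card {x. \<forall>i. x $ i \<in> A i} = (\<Prod>i\<in>UNIV. card (A i))"
  using bij_betw_same_card[OF bij_betw_vec_nth_box[of A]] by (simp add: card_PiE)

lemma finite_vec_box:
  assumes "\<And>i. finite (A i)"
  shows "finite {x. \<forall>i. x $ i \<in> A i}"
  using bij_betw_finite[OF bij_betw_vec_nth_box[of A]] assms by (simp add: finite_PiE)

theorem lemma5p5: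
  fixes l u :: "int ^ 'd" and s :: real
  assumes "\<And>i. l $ i \<le> u $ i"
    and "0 \<le> s" and "s < 1 / 2"
  shows "real (card (representative_states s l u))
           \<le> (sqrt 2 / (1 - s)) ^ CARD('d) * real (card (state_space l u)) powr (1 - s)"
proof -
  let ?G = "\<lambda>i. axis_grid s (l $ i) (u $ i)"
  have "finite {x. \<forall>i. x $ i \<in> ?G i}"
    by (intro finite_vec_box finite_axis_grid)
  \<comment> \<open>Keeping only the grid condition leaves a product set, so the count factors over
    the axes.\<close>
  then have "card (representative_states s l u) \<le> card {x. \<forall>i. x $ i \<in> ?G i}"
    by (rule card_mono) (auto simp: representative_states_def)
  then have "real (card (representative_states s l u)) \<le> (\<Prod>i\<in>UNIV. real (card (?G i)))"
    by (simp add: card_vec_box flip: of_nat_prod)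
  also have "\<dots> \<le> (\<Prod>i\<in>UNIV. sqrt 2 * gauge s (real_of_int (u $ i - l $ i + 1)))"
    using assms by (intro prod_mono conjI card_axis_grid) auto
  also have "\<dots> = (\<Prod>i\<in>(UNIV :: 'd set). sqrt 2 / (1 - s) * real_of_int (u $ i - l $ i + 1) powr (1 - s))"
    by (simp add: gauge_def)
  also have "\<dots> = (sqrt 2 / (1 - s)) ^ CARD('d) * (\<Prod>i\<in>(UNIV :: 'd set). real_of_int (u $ i - l $ i + 1)) powr (1 - s)"
    by (simp only: prod.distrib prod_constant prod_powr_distrib)
  also have "(\<Prod>i\<in>(UNIV :: 'd set). real_of_int (u $ i - l $ i + 1)) = real (card (state_space l u))"
    using assms(1) by (simp add: state_space_def card_vec_box[of "\<lambda>i. {l $ i..u $ i}", simplified] add.commute)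
  finally show ?thesis .
qed

end
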